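(* Let $\mathcal G$ be a connected, compact, finite metric graph of total length $L$ and discrete edge connectivity $\eta\in\mathbb N$, and let $\ell_{\max}$ be the length of the longest edge of $\mathcal G$. Then the smallest nonzero eigenvalue $\mu_1(\mathcal G)$ of the Laplacian on $\mathcal G$ with natural vertex conditions satisfies $$\mu_1(\mathcal G)\ \ge\ \frac{\eta^2\pi^2}{\bigl(L+\ell_{\max}(\eta-2)_+\bigr)^2},$$ where $(x)_+=\max\{x,0\}$.
   Context: A metric graph $\mathcal G$ here is connected and consists of finitely many edges of finite length (each edge $e$ identified with an interval $[0,\ell_e]$), joined at finitely many vertices; loops and multiple edges are allowed. It is assumed that $\mathcal G$ has no vertices of degree two (such a vertex can be suppressed by merging its two incident edges into one edge without affecting the problem), the only exception being the cycle graph, viewed as one vertex with one loop. $L$ is the sum of the edge lengths. Discrete edge connectivity $\eta$: after suppressing all vertices of degree two (if possible), if the resulting graph has more than one vertex, $\eta$ is the minimal number of edges that need to be deleted in order to make it disconnected; if it has only one vertex (a flower graph, including the cycle graph), set $\eta=2$. The Laplacian acts as $-u''$ on each edge; natural vertex conditions mean that $u$ is continuous on $\mathcal G$ and at each vertex the sum of the derivatives of $u$ (taken in the direction into the edges) over all incident edge ends is zero. Equivalently, $$\mu_1(\mathcal G)=\inf\left\{\frac{\int_{\mathcal G}|u'|^2dx}{\int_{\mathcal G}|u|^2dx}: 0\ne u\in H^1(\mathcal G),\ \int_{\mathcal G}u\,dx=0\right\},$$ where $H^1(\mathcal G)$ is the space of continuous functions on $\mathcal G$ that are $H^1$ on every edge.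 *)

theory Defs
  imports "Graph_Theory.Digraph_Component" "HOL-Analysis.Analysis"
begin

text \<open>
  The underlying combinatorial graph is a finite multidigraph with loops and parallel arcs allowed.
  The orientation of an arc \<open>e\<close> only fixes its parametrisation by \<open>[0, l e]\<close>: the point \<open>0\<close>
  is glued to \<open>tail G e\<close> and the point \<open>l e\<close> to \<open>head G e\<close>.  Graph-theoretic connectedness
  is that of the underlying undirected graph.
\<close>

locale metric_graph = fin_digraph G
  for G :: "('a, 'b) pre_digraph" and l :: "'b \<Rightarrow> real" +
  assumes connected_graph: "Digraph_Component.connected G"
    and has_edge: "arcs G \<noteq> {}"
    and length_pos: "e \<in> arcs G \<Longrightarrow> 0 < l e"

text \<open>A loop contributes two to the degree of its vertex.\<close>

definition vertex_degree :: "('a, 'b) pre_digraph \<Rightarrow> 'a \<Rightarrow> nat" where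
  "vertex_degree G v = out_degree G v + in_degree G v"

definition is_cycle_graph :: "('a, 'b) pre_digraph \<Rightarrow> bool" where
  "is_cycle_graph G \<longleftrightarrow> card (verts G) = 1 \<and> card (arcs G) = 1"

definition degree_two_suppressed :: "('a, 'b) pre_digraph \<Rightarrow> bool" where
  "degree_two_suppressed G \<longleftrightarrow> is_cycle_graph G \<or> (\<forall>v\<in>verts G. vertex_degree G v \<noteq> 2)"

definition total_length :: "('a, 'b) pre_digraph \<Rightarrow> ('b \<Rightarrow> real) \<Rightarrow> real" where
  "total_length G l = (\<Sum>e\<in>arcs G. l e)"

definition max_edge_length :: "('a, 'b) pre_digraph \<Rightarrow> ('b \<Rightarrow> real) \<Rightarrow> real" where
  "max_edge_length G l = Max (l ` arcs G)"

definition delete_edges :: "('a, 'b) pre_digraph \<Rightarrow> 'b set \<Rightarrow> ('a, 'b) pre_digraph" where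
  "delete_edges G F = G\<lparr>arcs := arcs G - F\<rparr>"

text \<open>
  To be applied to graphs without vertices of degree two (see \<open>degree_two_suppressed\<close>).
  The value 2 on one-vertex graphs (flowers, including the cycle) is a convention.
\<close>

definition edge_connectivity :: "('a, 'b) pre_digraph \<Rightarrow> nat" where
  "edge_connectivity G =
     (if card (verts G) = 1 then 2
      else LEAST k. \<exists>F \<subseteq> arcs G. card F = k \<and>
             \<not> Digraph_Component.connected (delete_edges G F))"

text \<open>
  A function on the metric graph is a family \<open>u\<close> with \<open>u e\<close> considered on \<open>{0..l e}\<close>, and
  \<open>du\<close> is the family of its edgewise derivatives in the direction from tail to head.
  Continuity means a common value \<open>f v\<close> at all edge ends glued to \<open>v\<close>.  The derivative
  into the edge is \<open>du e 0\<close> at the tail and \<open>- du e (l e)\<close> at the head.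
\<close>

definition natural_conditions ::
  "('a, 'b) pre_digraph \<Rightarrow> ('b \<Rightarrow> real) \<Rightarrow> ('b \<Rightarrow> real \<Rightarrow> real) \<Rightarrow> ('b \<Rightarrow> real \<Rightarrow> real) \<Rightarrow> bool" where
  "natural_conditions G l u du \<longleftrightarrow>
     (\<exists>f. \<forall>e\<in>arcs G. u e 0 = f (tail G e) \<and> u e (l e) = f (head G e)) \<and>
     (\<forall>v\<in>verts G. (\<Sum>e\<in>out_arcs G v. du e 0) + (\<Sum>e\<in>in_arcs G v. - du e (l e)) = 0)"

text \<open>
  The solutions of \<open>- u'' = lam u\<close> in the operator domain are automatically smooth up to the
  end points of each edge, so classical (at end points: one-sided) derivatives are used.
\<close>

definition laplacian_eigenfunction ::
  "('a, 'b) pre_digraph \<Rightarrow> ('b \<Rightarrow> real) \<Rightarrow> real \<Rightarrow> ('b \<Rightarrow> real \<Rightarrow> real) \<Rightarrow> bool" where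
  "laplacian_eigenfunction G l lam u \<longleftrightarrow>
     (\<exists>e\<in>arcs G. \<exists>x\<in>{0..l e}. u e x \<noteq> 0) \<and>
     (\<exists>du ddu.
        (\<forall>e\<in>arcs G. \<forall>x\<in>{0..l e}.
           (u e has_real_derivative du e x) (at x within {0..l e}) \<and>
           (du e has_real_derivative ddu e x) (at x within {0..l e}) \<and>
           - ddu e x = lam * u e x) \<and>
        natural_conditions G l u du)"

definition laplacian_eigenvalue :: "('a, 'b) pre_digraph \<Rightarrow> ('b \<Rightarrow> real) \<Rightarrow> real \<Rightarrow> bool" where
  "laplacian_eigenvalue G l lam \<longleftrightarrow> (\<exists>u. laplacian_eigenfunction G l lam u)"

definition smallest_nonzero_eigenvalue :: "('a, 'b) pre_digraph \<Rightarrow> ('b \<Rightarrow> real) \<Rightarrow> real \<Rightarrow> bool" where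
  "smallest_nonzero_eigenvalue G l mu \<longleftrightarrow>
     laplacian_eigenvalue G l mu \<and> mu \<noteq> 0 \<and>
     (\<forall>lam. laplacian_eigenvalue G l lam \<and> lam \<noteq> 0 \<longrightarrow> mu \<le> lam)"

end

theory Submission
  imports Defs
begin

text \<open>
  Write \<open>k\<^sup>2\<close> for the eigenvalue, and let \<open>M\<close> and \<open>- m\<close> be the maximum and the minimum of an
  eigenfunction \<open>u\<close> on the graph; both \<open>M\<close> and \<open>m\<close> are positive because \<open>u\<close> has mean zero.
  If \<open>u\<close> takes each of its values \<open>\<eta>\<close> times, comparison with \<open>\<eta>\<close> parallel intervals, each carrying
  half a cosine wave, suggests \<open>k * L \<ge> \<eta> * pi\<close>.  The usual route to this bound is rearrangement
  of \<open>u\<close> and the coarea formula; here a calibration gives it directly.  Where \<open>u > 0\<close>, expand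

    \<open>0 \<le> (\<bar>u'\<bar> / M - k * sqrt (1 - (u / M)\<^sup>2))\<^sup>2\<close>,

  and do the same with \<open>m\<close> where \<open>u < 0\<close>.  The outcome is the pointwise inequality

    \<open>2 * k * \<bar>(profile u)'\<bar> \<le> (weight u * u' + k\<^sup>2 * x)'\<close>,

  in which \<open>weight\<close> is linear on each side of zero and \<open>profile\<close> maps \<open>{- m..M}\<close> onto an interval of
  length \<open>pi / 2\<close> (lemma \<open>weighted_flux_bounds_profile\<close>).  Summed over all edges, the terms
  \<open>weight u * u'\<close> cancel by the Kirchhoff condition, and \<open>2 * k\<close> times the total variation of
  \<open>profile u\<close> is at most \<open>k\<^sup>2 * L\<close>.

  It remains to bound the total variation from below.  Let \<open>D\<close> be the oscillation of \<open>profile u\<close> over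
  the vertices.  A level strictly between the extreme vertex values is crossed by at least \<open>\<eta>\<close> edges,
  since the crossing edges form a cut; this contributes \<open>\<eta> * D\<close>
  (lemma \<open>edge_connectivity_times_oscillation_le\<close>).  Any other level in the range of \<open>u\<close> is passed
  upwards and downwards on the edge that carries the maximum or the minimum; this contributes
  \<open>2 * (pi / 2 - D)\<close>.  Hence \<open>k * L \<ge> 2 * (pi + (\<eta> - 2) * D)\<close>.  For \<open>\<eta> \<le> 2\<close> the bound
  follows from \<open>D \<le> pi / 2\<close>.  For \<open>\<eta> > 2\<close> the deficit \<open>pi / 2 - D\<close> must be paid by long edges: above
  all vertex values \<open>u\<close> is a cap of the cosine \<open>M * cos (k * (x - x0))\<close> that fits into one edge
  (lemma \<open>edge_length_ge_cap\<close>), and likewise below all of them, which yields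
  \<open>pi / 2 - D \<le> k * l_max / 2\<close>.
\<close>

section \<open>Two facts from real analysis\<close>

text \<open>
  The comparison functions below have corners where \<open>u\<close> vanishes and are smooth only strictly between
  its extreme values, so monotonicity is needed with finitely many exceptional points.
\<close>

lemma nondecreasing_off_finite:
  fixes f :: "real \<Rightarrow> real"
  assumes "finite S" "a \<le> b" "continuous_on {a..b} f"
    and der: "\<And>x. x \<in> {a<..<b} - S \<Longrightarrow> \<exists>d\<ge>0. (f has_real_derivative d) (at x)"
  shows "f a \<le> f b"
proof -
  define d where "d x = (if x \<in> {a<..<b} - S then SOME d. 0 \<le> d \<and> (f has_real_derivative d) (at x) else 0)" for x
  have d: "0 \<le> d x \<and> (f has_real_derivative d x) (at x)" if "x \<in> {a<..<b} - S" for x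
    using someI_ex[OF der[OF that, unfolded Bex_def]] that by (auto simp: d_def)
  have "0 \<le> d x" for x
    using d[of x] by (cases "x \<in> {a<..<b} - S") (auto simp: d_def)
  moreover have "(d has_integral (f b - f a)) {a..b}"
    using d assms(1-3)
    by (intro fundamental_theorem_of_calculus_interior_strong)
       (auto simp: has_real_derivative_iff_has_vector_derivative)
  ultimately show ?thesis
    using has_integral_nonneg[of d "f b - f a" "{a..b}"] by simp
qed

text \<open>
  Periodicity leaves, of each of the two solutions modulo the period, only the finitely many
  translates that meet a bounded interval.
\<close>

lemma finite_cos_level: "finite {y \<in> {a..b}. cos y = (c::real)}"
proof (cases "\<exists>y0. cos y0 = c")
  case True
  then obtain y0 where y0: "cos y0 = c" by blast
  \<comment> \<open>\<open>N\<close> contains every number of periods by which a solution in \<open>{a..b}\<close> can differ from \<open>\<plusminus> y0\<close>.\<close>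
  define N where "N = {n::int. \<bar>of_int n\<bar> \<le> (\<bar>a\<bar> + \<bar>b\<bar> + \<bar>y0\<bar>) / (2*pi)}"
  have "finite N"
  proof (rule finite_subset)
    show "N \<subseteq> {- \<lceil>(\<bar>a\<bar> + \<bar>b\<bar> + \<bar>y0\<bar>) / (2*pi)\<rceil>..\<lceil>(\<bar>a\<bar> + \<bar>b\<bar> + \<bar>y0\<bar>) / (2*pi)\<rceil>}"
      unfolding N_def by (auto simp: abs_le_iff) linarith+
  qed simp
  moreover have "{y \<in> {a..b}. cos y = c} \<subseteq> (\<lambda>n. y0 + 2 * of_int n * pi) ` N \<union> (\<lambda>n. - y0 + 2 * of_int n * pi) ` N"
  proof
    fix y assume "y \<in> {y \<in> {a..b}. cos y = c}"
    then have y: "a \<le> y" "y \<le> b" "cos y = cos y0" using y0 by auto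
    then obtain n :: int where n: "y = y0 + 2 * of_int n * pi \<or> y = - y0 + 2 * of_int n * pi"
      unfolding cos_eq by (auto elim!: Ints_cases)
    then have "\<bar>2 * of_int n * pi\<bar> \<le> \<bar>a\<bar> + \<bar>b\<bar> + \<bar>y0\<bar>" using y by linarith
    then have "n \<in> N" by (simp add: N_def field_simps abs_mult)
    then show "y \<in> (\<lambda>n. y0 + 2 * of_int n * pi) ` N \<union> (\<lambda>n. - y0 + 2 * of_int n * pi) ` N"
      using n by blast
  qed
  ultimately show ?thesis by (meson finite_Un finite_imageI finite_subset)
next
  case False
  then show ?thesis by simp
qed

section \<open>Solutions on a single edge\<close>

definition helmholtz_on :: "real \<Rightarrow> real \<Rightarrow> (real \<Rightarrow> real) \<Rightarrow> (real \<Rightarrow> real) \<Rightarrow> bool" where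
  "helmholtz_on k l u du \<longleftrightarrow> (\<forall>x\<in>{0..l}.
     (u has_real_derivative du x) (at x within {0..l}) \<and>
     (du has_real_derivative - (k\<^sup>2 * u x)) (at x within {0..l}))"

lemma helmholtz_on_uminus:
  "helmholtz_on k l u du \<Longrightarrow> helmholtz_on k l (\<lambda>x. - u x) (\<lambda>x. - du x)"
  unfolding helmholtz_on_def by (auto intro!: derivative_eq_intros)

lemma helmholtz_on_continuous:
  assumes "helmholtz_on k l u du"
  shows "continuous_on {0..l} u" "continuous_on {0..l} du"
  using assms unfolding helmholtz_on_def continuous_on_eq_continuous_within
  by (auto intro: DERIV_continuous)

lemma helmholtz_on_interior:
  assumes "helmholtz_on k l u du" "0 < x" "x < l"
  shows "(u has_real_derivative du x) (at x)" "(du has_real_derivative - (k\<^sup>2 * u x)) (at x)"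
  using assms unfolding helmholtz_on_def by (auto simp: at_within_Icc_at dest: bspec[of _ _ x])

text \<open>
  The right-hand side, regarded as a function of the base point \<open>x\<close>, has derivative zero and equals
  \<open>u y\<close> at \<open>x = y\<close>.  This is uniqueness for the initial value problem in explicit form.
\<close>

lemma helmholtz_on_explicit:
  assumes h: "helmholtz_on k l u du" and k: "0 < k" and x: "x \<in> {0..l}" and y: "y \<in> {0..l}"
  shows "u y = u x * cos (k * (y - x)) + du x / k * sin (k * (y - x))"
proof -
  define g where "g z = u z * cos (k * (y - z)) + du z / k * sin (k * (y - z))" for z
  have "(g has_real_derivative 0) (at z within {0..l})" if "z \<in> {0..l}" for z
  proof -
    have "(u has_real_derivative du z) (at z within {0..l})"
      "(du has_real_derivative - (k\<^sup>2 * u z)) (at z within {0..l})"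
      using h that unfolding helmholtz_on_def by auto
    then show ?thesis
      unfolding g_def using k
      by (auto intro!: derivative_eq_intros simp: field_simps power2_eq_square)
  qed
  then obtain c where "\<forall>z\<in>{0..l}. g z = c"
    using has_field_derivative_zero_constant[of "{0..l}" g] by auto
  then have "g x = g y" using x y by simp
  then show ?thesis by (simp add: g_def)
qed

lemma helmholtz_on_finite_level:
  assumes h: "helmholtz_on k l u du" and k: "0 < k" and nz: "x0 \<in> {0..l}" "u x0 \<noteq> 0"
  shows "finite {x \<in> {0..l}. u x = t}"
proof -
  obtain A \<psi> where A: "u 0 = A * cos \<psi>" "du 0 / k = A * sin \<psi>"
    using polar_Ex by blast
  have u: "u x = A * cos (k * x - \<psi>)" if "x \<in> {0..l}" for x
    using helmholtz_on_explicit[OF h k, of 0 x] that A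
    by (simp add: cos_diff algebra_simps)
  have "A \<noteq> 0" using u nz by auto
  have "finite ((\<lambda>y. (y + \<psi>) / k) ` {y \<in> {- \<psi>..k * l - \<psi>}. cos y = t / A})"
    by (intro finite_imageI finite_cos_level)
  moreover have "{x \<in> {0..l}. u x = t} \<subseteq> (\<lambda>y. (y + \<psi>) / k) ` {y \<in> {- \<psi>..k * l - \<psi>}. cos y = t / A}"
  proof
    fix x assume x: "x \<in> {x \<in> {0..l}. u x = t}"
    then have "k * x - \<psi> \<in> {y \<in> {- \<psi>..k * l - \<psi>}. cos y = t / A}"
      using u[of x] \<open>A \<noteq> 0\<close> k by auto
    then show "x \<in> (\<lambda>y. (y + \<psi>) / k) ` {y \<in> {- \<psi>..k * l - \<psi>}. cos y = t / A}"
      using k by (intro image_eqI[of _ _ "k * x - \<psi>"]) auto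
  qed
  ultimately show ?thesis by (rule rev_finite_subset)
qed

text \<open>
  At an interior maximum the derivative vanishes, so \<open>u\<close> is the cosine \<open>M * cos (k * (x - x0))\<close> along
  the entire edge.  That cosine does not drop to \<open>M * cos (k * s)\<close> within distance less than \<open>s\<close> of its
  crest, whereas both ends of the edge lie at or below this height.
\<close>

lemma edge_length_ge_cap:
  assumes h: "helmholtz_on k l u du" and k: "0 < k" and l: "0 < l"
    and x0: "x0 \<in> {0..l}" "u x0 = M" and M: "0 < M" and max: "\<And>x. x \<in> {0..l} \<Longrightarrow> u x \<le> M"
    and s: "0 \<le> s" "k * s \<le> pi"
    and ends: "u 0 \<le> M * cos (k * s)" "u l \<le> M * cos (k * s)"
  shows "2 * s \<le> l"
proof (cases "s = 0")
  case True
  then show ?thesis using l by simp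
next
  case False
  then have s0: "0 < k * s" using s k by simp
  have "cos (k * s) < 1"
    using cos_monotone_0_pi[of 0 "k * s"] s0 s by simp
  then have "M * cos (k * s) < M" using M by simp
  then have "x0 \<noteq> 0" "x0 \<noteq> l" using ends x0 by auto
  then have int: "0 < x0" "x0 < l" using x0 by auto
  have "du x0 = 0"
  proof (rule DERIV_local_max[OF helmholtz_on_interior(1)[OF h int]])
    show "0 < min x0 (l - x0)" using int by simp
    show "\<forall>y. \<bar>x0 - y\<bar> < min x0 (l - x0) \<longrightarrow> u y \<le> u x0"
    proof (intro allI impI)
      fix y assume "\<bar>x0 - y\<bar> < min x0 (l - x0)"
      then have "y \<in> {0..l}" by (simp add: abs_less_iff)
      then show "u y \<le> u x0" using max x0 by simp
    qed
  qed
  then have u: "u y = M * cos (k * (y - x0))" if "y \<in> {0..l}" for y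
    using helmholtz_on_explicit[OF h k x0(1) that] x0 by simp
  have far: "s \<le> r" if "0 \<le> r" "M * cos (k * r) \<le> M * cos (k * s)" for r
  proof (rule ccontr)
    assume "\<not> s \<le> r"
    then have "cos (k * s) < cos (k * r)"
      using cos_monotone_0_pi[of "k * r" "k * s"] that k s by simp
    then show False using that M by simp
  qed
  have "s \<le> x0" using far[of x0] u[of 0] ends int by simp
  moreover have "s \<le> l - x0" using far[of "l - x0"] u[of l] ends int by simp
  ultimately show ?thesis by simp
qed

section \<open>The comparison profile\<close>

text \<open>
  The primitive of \<open>sqrt (1 - s\<^sup>2)\<close> that vanishes at \<open>0\<close>: the signed area of the part of the upper
  unit half disc \<open>{(s, y). s\<^sup>2 + y\<^sup>2 \<le> 1, y \<ge> 0}\<close> over the interval from \<open>0\<close> to \<open>s\<close>.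
\<close>

definition half_disc :: "real \<Rightarrow> real" where
  "half_disc s = (arcsin s + s * sqrt (1 - s\<^sup>2)) / 2"

lemma half_disc_simps [simp]: "half_disc 0 = 0" "half_disc 1 = pi / 4" "half_disc (-1) = - pi / 4"
  by (simp_all add: half_disc_def)

lemma half_disc_minus: "-1 \<le> s \<Longrightarrow> s \<le> 1 \<Longrightarrow> half_disc (- s) = - half_disc s"
  by (simp add: half_disc_def arcsin_minus field_simps)

lemma half_disc_deriv:
  assumes "-1 < s" "s < 1"
  shows "(half_disc has_real_derivative sqrt (1 - s\<^sup>2)) (at s)"
proof -
  have "s\<^sup>2 < 1" using assms by (simp add: abs_square_less_1)
  then have q: "0 < sqrt (1 - s\<^sup>2)" "(sqrt (1 - s\<^sup>2))\<^sup>2 = 1 - s\<^sup>2" by auto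
  show ?thesis
    unfolding half_disc_def
    apply (rule derivative_eq_intros refl | use assms \<open>s\<^sup>2 < 1\<close> in force)+
    using q by (simp add: field_simps power2_eq_square)
qed

lemma half_disc_continuous: "continuous_on {-1..1} half_disc"
  unfolding half_disc_def by (intro continuous_intros) auto

lemma half_disc_mono:
  assumes "-1 \<le> s" "s \<le> t" "t \<le> 1"
  shows "half_disc s \<le> half_disc t"
proof (rule DERIV_nonneg_imp_increasing_open[OF assms(2)])
  show "\<exists>y. (half_disc has_real_derivative y) (at x) \<and> 0 \<le> y" if "s < x" "x < t" for x
    using half_disc_deriv[of x] assms that by (auto simp: abs_square_le_1)
  show "continuous_on {s..t} half_disc"
    by (rule continuous_on_subset[OF half_disc_continuous]) (use assms in auto)
qed

text \<open>
  The area of half a circular cap is that of a sector minus that of a triangle.  This turns a defect of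
  the profile into an angle, hence into a length of edge.
\<close>

lemma half_disc_cap:
  assumes "0 \<le> s" "s \<le> 1"
  shows "pi / 4 - half_disc s \<le> arccos s / 2"
proof -
  have "0 \<le> s * sqrt (1 - s\<^sup>2)" using assms by (simp add: power_le_one)
  then show ?thesis
    using assms by (simp add: half_disc_def arccos_arcsin_eq field_simps)
qed

text \<open>
  The positive values of \<open>u\<close> are measured against a cosine of amplitude \<open>M\<close> and the negative ones
  against a cosine of amplitude \<open>m\<close>; one of the two summands is always zero.  The same holds for
  \<open>weight\<close>.  Both functions are continuous at \<open>0\<close> but have a corner there unless \<open>M = m\<close>.
\<close>

definition profile :: "real \<Rightarrow> real \<Rightarrow> real \<Rightarrow> real" where
  "profile M m t = half_disc (max t 0 / M) + half_disc (min t 0 / m)"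

definition weight :: "real \<Rightarrow> real \<Rightarrow> real \<Rightarrow> real" where
  "weight M m t = max t 0 / M\<^sup>2 + min t 0 / m\<^sup>2"

lemma profile_mono:
  assumes "0 < M" "0 < m" "- m \<le> s" "s \<le> t" "t \<le> M"
  shows "profile M m s \<le> profile M m t"
  unfolding profile_def using assms
  by (intro add_mono half_disc_mono) (auto simp: field_simps max_def min_def)

lemma profile_continuous:
  assumes "0 < M" "0 < m"
  shows "continuous_on {- m..M} (profile M m)"
proof -
  have "continuous_on {- m..M} (\<lambda>t. max t 0 / M)" "continuous_on {- m..M} (\<lambda>t. min t 0 / m)"
    using assms by (auto intro!: continuous_intros)
  moreover have "max t 0 / M \<in> {-1..1}" "min t 0 / m \<in> {-1..1}" if "t \<in> {- m..M}" for t
    using assms that by (auto simp: field_simps)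
  ultimately show ?thesis
    unfolding profile_def
    by (intro continuous_on_add continuous_on_compose2[OF half_disc_continuous]) auto
qed

lemma profile_extreme: "0 < M \<Longrightarrow> 0 < m \<Longrightarrow> profile M m M = pi / 4"
  "0 < M \<Longrightarrow> 0 < m \<Longrightarrow> profile M m (- m) = - pi / 4"
  by (simp_all add: profile_def)

text \<open>
  The calibration.  With \<open>q = sqrt (1 - (u / A)\<^sup>2)\<close>, where the amplitude \<open>A\<close> is \<open>M\<close> or \<open>m\<close>, the
  equation \<open>u'' = - k\<^sup>2 * u\<close> turns the derivative of \<open>weight u * u' + k\<^sup>2 * x\<close> into
  \<open>(u' / A)\<^sup>2 + k\<^sup>2 * q\<^sup>2\<close>, and that of \<open>profile u\<close> is \<open>q * u' / A\<close>.  Twice a product is at most the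
  sum of the squares.
\<close>

lemma weighted_flux_bounds_profile:
  assumes h: "helmholtz_on k l u du" and k: "0 < k" and M: "0 < M" and m: "0 < m"
    and bound: "\<And>x. x \<in> {0..l} \<Longrightarrow> - m \<le> u x \<and> u x \<le> M"
    and xy: "0 \<le> x" "x \<le> y" "y \<le> l"
  shows "2 * k * \<bar>profile M m (u y) - profile M m (u x)\<bar>
    \<le> (weight M m (u y) * du y + k\<^sup>2 * y) - (weight M m (u x) * du x + k\<^sup>2 * x)"
proof (cases "\<forall>z\<in>{0..l}. u z = 0")
  case True
  then have "u x = 0" "u y = 0" using xy by auto
  then show ?thesis using xy k by (simp add: weight_def mult_left_mono)
next
  case False
  then obtain x0 where "x0 \<in> {0..l}" "u x0 \<noteq> 0" by blast
  note fin = helmholtz_on_finite_level[OF h k this]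
  define S where "S = {x \<in> {0..l}. u x = 0} \<union> {x \<in> {0..l}. u x = M} \<union> {x \<in> {0..l}. u x = - m}"
  have "finite S" using fin by (simp add: S_def)
  \<comment> \<open>For \<open>\<sigma> = 1\<close> and \<open>\<sigma> = - 1\<close>, monotonicity of \<open>D \<sigma>\<close> bounds the increment of the profile and its
    negative.\<close>
  define D where "D \<sigma> z = weight M m (u z) * du z + k\<^sup>2 * z - \<sigma> * (2 * k * profile M m (u z))" for \<sigma> z
  have sub: "{x..y} \<subseteq> {0..l}" using xy by auto
  have cu: "continuous_on {x..y} u" and cdu: "continuous_on {x..y} du"
    using helmholtz_on_continuous[OF h] sub by (auto intro: continuous_on_subset)
  have cont: "continuous_on {x..y} (D \<sigma>)" for \<sigma>
  proof -
    have "continuous_on {x..y} (\<lambda>z. profile M m (u z))"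
      using bound sub by (intro continuous_on_compose2[OF profile_continuous[OF M m] cu]) auto
    then show ?thesis
      unfolding D_def weight_def using cu cdu by (intro continuous_intros) (use M m in auto)
  qed
  have incr: "D \<sigma> x \<le> D \<sigma> y" if \<sigma>: "\<sigma> = 1 \<or> \<sigma> = -1" for \<sigma>
  proof (rule nondecreasing_off_finite[OF \<open>finite S\<close> xy(2) cont])
    fix z assume z: "z \<in> {x<..<y} - S"
    then have zl: "0 < z" "z < l" and zS: "u z \<noteq> 0" "u z \<noteq> M" "u z \<noteq> - m" 
      using xy by (auto simp: S_def)
    then have zb: "- m < u z" "u z < M" using bound[of z] by auto
    note du = helmholtz_on_interior[OF h zl]
    have lim: "(u \<longlongrightarrow> u z) (nhds z)"
      using DERIV_isCont[OF du(1)] by (simp add: continuous_at tendsto_at_iff_tendsto_nhds)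
    \<comment> \<open>On either side of zero a single amplitude \<open>A\<close> enters, \<open>M\<close> or \<open>m\<close>, and the
      derivative of \<open>D \<sigma>\<close> is a square.\<close>
    have one: "\<exists>d\<ge>0. (D \<sigma> has_real_derivative d) (at z)"
      if A: "0 < A" "\<bar>u z\<bar> < A"
        and ev: "eventually (\<lambda>w. D \<sigma> w = (u w / A\<^sup>2) * du w + k\<^sup>2 * w - \<sigma> * (2 * k * half_disc (u w / A))) (nhds z)"
      for A
    proof -
      define q where "q = sqrt (1 - (u z / A)\<^sup>2)"
      have A1: "-1 < u z / A" "u z / A < 1" using A by (auto simp: field_simps)
      then have "(u z / A)\<^sup>2 < 1" by (simp add: abs_square_less_1)
      then have q2: "q\<^sup>2 = 1 - (u z)\<^sup>2 / A\<^sup>2" by (simp add: q_def power_divide)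
      have hd: "((\<lambda>w. half_disc (u w / A)) has_real_derivative q * (du z / A)) (at z)"
        unfolding q_def
        by (rule DERIV_chain2[where g = "\<lambda>w. u w / A", OF half_disc_deriv[OF A1]]) (use du A in \<open>auto intro!: derivative_eq_intros\<close>)
      have "((\<lambda>w. (u w / A\<^sup>2) * du w + k\<^sup>2 * w - \<sigma> * (2 * k * half_disc (u w / A)))
         has_real_derivative (du z / A\<^sup>2 * du z + - (k\<^sup>2 * u z) * (u z / A\<^sup>2) + k\<^sup>2 - \<sigma> * (2 * k * (q * (du z / A))))) (at z)"
        by (rule DERIV_diff[OF DERIV_add[OF DERIV_mult[OF DERIV_cdivide[OF du(1)] du(2)] DERIV_cmult_Id]
              DERIV_cmult[OF DERIV_cmult[OF hd]]])
      moreover have "du z / A\<^sup>2 * du z + - (k\<^sup>2 * u z) * (u z / A\<^sup>2) + k\<^sup>2 - \<sigma> * (2 * k * (q * (du z / A)))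
          = (du z / A)\<^sup>2 + k\<^sup>2 * q\<^sup>2 - \<sigma> * (2 * k * (q * (du z / A)))"
        by (simp add: q2) (simp add: power2_eq_square algebra_simps)
      also have "\<dots> = (du z / A - \<sigma> * k * q)\<^sup>2"
        using \<sigma> by (auto simp: power2_eq_square algebra_simps)
      finally have "((\<lambda>w. (u w / A\<^sup>2) * du w + k\<^sup>2 * w - \<sigma> * (2 * k * half_disc (u w / A)))
         has_real_derivative (du z / A - \<sigma> * k * q)\<^sup>2) (at z)" .
      then have "(D \<sigma> has_real_derivative (du z / A - \<sigma> * k * q)\<^sup>2) (at z)"
        using DERIV_cong_ev[OF refl ev refl] by simp
      then show ?thesis by (meson zero_le_power2)
    qed
    show "\<exists>d\<ge>0. (D \<sigma> has_real_derivative d) (at z)"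
    proof (cases "0 < u z")
      case True
      show ?thesis
        by (rule one[of M], use True zb M in simp_all)
           (use order_tendstoD(1)[OF lim True] in eventually_elim, simp add: D_def weight_def profile_def)
    next
      case False
      then have neg: "u z < 0" using zS by simp
      show ?thesis
        by (rule one[of m], use neg zb m in simp_all)
           (use order_tendstoD(2)[OF lim neg] in eventually_elim, simp add: D_def weight_def profile_def)
    qed
  qed
  from incr[of 1] incr[of "-1"] show ?thesis
    by (simp add: D_def abs_if algebra_simps)
qed

text \<open>
  A path from one end of the edge to the other that visits both the minimum and the maximum of the
  profile has variation at least twice the oscillation minus the difference of the end values,
  whichever extremum comes first.
\<close>

lemma profile_variation_on_edge:
  assumes h: "helmholtz_on k l u du" and k: "0 < k" and l: "0 < l" and M: "0 < M" and m: "0 < m"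
    and bound: "\<And>x. x \<in> {0..l} \<Longrightarrow> - m \<le> u x \<and> u x \<le> M"
  shows "\<exists>lo hi. (\<forall>x\<in>{0..l}. lo \<le> profile M m (u x) \<and> profile M m (u x) \<le> hi) \<and>
    2 * k * (2 * (hi - lo) - \<bar>profile M m (u l) - profile M m (u 0)\<bar>)
      \<le> k\<^sup>2 * l + (weight M m (u l) * du l - weight M m (u 0) * du 0)"
proof -
  define v where "v x = profile M m (u x)" for x
  have cv: "continuous_on {0..l} v"
    unfolding v_def using bound
    by (intro continuous_on_compose2[OF profile_continuous[OF M m] helmholtz_on_continuous(1)[OF h]]) auto
  have ne: "{0..l} \<noteq> {}" using l by auto
  obtain p where p: "p \<in> {0..l}" "\<And>x. x \<in> {0..l} \<Longrightarrow> v p \<le> v x"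
    using continuous_attains_inf[OF compact_Icc ne cv] by blast
  obtain q where q: "q \<in> {0..l}" "\<And>x. x \<in> {0..l} \<Longrightarrow> v x \<le> v q"
    using continuous_attains_sup[OF compact_Icc ne cv] by blast
  define Q where "Q x = weight M m (u x) * du x + k\<^sup>2 * x" for x
  have step: "2 * k * \<bar>v y - v x\<bar> \<le> Q y - Q x" if "0 \<le> x" "x \<le> y" "y \<le> l" for x y
    unfolding v_def Q_def using weighted_flux_bounds_profile[OF h k M m bound that] by simp
  have ends: "v p \<le> v 0" "v 0 \<le> v q" "v p \<le> v l" "v l \<le> v q" using p q l by auto
  define s t where "s = min p q" and "t = max p q"
  have st: "0 \<le> s" "s \<le> t" "t \<le> l" using p q by (auto simp: s_def t_def)
  have "2 * k * (\<bar>v s - v 0\<bar> + \<bar>v t - v s\<bar> + \<bar>v l - v t\<bar>) \<le> Q l - Q 0"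
    using step[of 0 s] step[of s t] step[of t l] st by (simp add: algebra_simps)
  moreover have "2 * (v q - v p) - \<bar>v l - v 0\<bar> \<le> \<bar>v s - v 0\<bar> + \<bar>v t - v s\<bar> + \<bar>v l - v t\<bar>"
    using ends by (cases "p \<le> q") (auto simp: s_def t_def)
  then have "2 * k * (2 * (v q - v p) - \<bar>v l - v 0\<bar>) \<le> 2 * k * (\<bar>v s - v 0\<bar> + \<bar>v t - v s\<bar> + \<bar>v l - v t\<bar>)"
    using k by simp
  ultimately have "2 * k * (2 * (v q - v p) - \<bar>v l - v 0\<bar>) \<le> Q l - Q 0" by linarith
  then have "2 * k * (2 * (v q - v p) - \<bar>v l - v 0\<bar>)
      \<le> k\<^sup>2 * l + (weight M m (u l) * du l - weight M m (u 0) * du 0)"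
    by (simp add: Q_def)
  then show ?thesis using p q unfolding v_def by blast
qed

section \<open>Cuts\<close>

lemma edge_connectivity_le:
  assumes "card (verts G) \<noteq> 1" "F \<subseteq> arcs G" "\<not> Digraph_Component.connected (delete_edges G F)"
  shows "edge_connectivity G \<le> card F"
  unfolding edge_connectivity_def using assms by (auto intro!: Least_le)

text \<open>
  Along an undirected walk from \<open>a\<close> the value of \<open>p\<close> stays below the level \<open>t\<close>.
\<close>

lemma disconnected_if_level_not_crossed:
  fixes p :: "'a \<Rightarrow> real"
  assumes ab: "a \<in> verts H" "b \<in> verts H" "p a < t" "t < p b"
    and nc: "\<And>e. e \<in> arcs H \<Longrightarrow> p (tail H e) < t \<longleftrightarrow> p (head H e) < t"
  shows "\<not> Digraph_Component.connected H"
proof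
  assume "Digraph_Component.connected H"
  then have "(a, b) \<in> rtrancl_on (verts H) ((arcs_ends H)\<^sup>s)"
    using ab by (simp add: connected_conv)
  then have "p b < t"
  proof (induction rule: rtrancl_on_induct)
    case base
    show ?case using ab by simp
  next
    case (step y z)
    then have "(y, z) \<in> arcs_ends H \<or> (z, y) \<in> arcs_ends H"
      by (auto simp: symcl_def)
    then obtain e where "e \<in> arcs H" "(tail H e = y \<and> head H e = z) \<or> (tail H e = z \<and> head H e = y)"
      by (auto simp: arcs_ends_def arc_to_ends_def)
    then show ?case using nc step by auto
  qed
  then show False using ab by simp
qed

text \<open>
  A discrete coarea formula: \<open>\<bar>p v - p w\<bar>\<close> is the length of the interval of levels that the edge
  from \<open>v\<close> to \<open>w\<close> crosses, and for every level strictly between \<open>p a\<close> and \<open>p b\<close> the crossing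
  edges separate \<open>a\<close> from \<open>b\<close>.  If there is only one vertex, the left-hand side is zero.
\<close>

lemma edge_connectivity_times_oscillation_le:
  fixes p :: "'a \<Rightarrow> real"
  assumes fin: "finite (arcs G)" and ab: "a \<in> verts G" "b \<in> verts G" and le: "p a \<le> p b"
  shows "real (edge_connectivity G) * (p b - p a) \<le> (\<Sum>e\<in>arcs G. \<bar>p (head G e) - p (tail G e)\<bar>)"
proof (cases "card (verts G) = 1")
  case True
  then have "a = b" using ab by (auto simp: card_1_singleton_iff)
  then show ?thesis by (simp add: sum_nonneg)
next
  case False
  define I where "I e = {min (p (head G e)) (p (tail G e))..max (p (head G e)) (p (tail G e))}" for e
  have int: "((\<lambda>t. if t \<in> I e then 1 else 0) has_integral \<bar>p (head G e) - p (tail G e)\<bar>) UNIV" for e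
    unfolding has_integral_restrict_UNIV I_def
    using has_integral_const_real[of "1::real" "min (p (head G e)) (p (tail G e))" "max (p (head G e)) (p (tail G e))"]
    by (auto simp: max_def min_def abs_if split: if_splits)
  have R: "((\<lambda>t. \<Sum>e\<in>arcs G. if t \<in> I e then 1 else 0) has_integral
      (\<Sum>e\<in>arcs G. \<bar>p (head G e) - p (tail G e)\<bar>)) UNIV"
    by (intro has_integral_sum fin int)
  have "((\<lambda>t. real (edge_connectivity G)) has_integral (edge_connectivity G * (p b - p a))) {p a<..<p b}"
    using has_integral_const_real[of "real (edge_connectivity G)" "p a" "p b"] le
    by (simp add: has_integral_Icc_iff_Ioo mult.commute)
  then have L: "((\<lambda>t. if t \<in> {p a<..<p b} then real (edge_connectivity G) else 0) has_integral
      (edge_connectivity G * (p b - p a))) UNIV"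
    by (simp only: has_integral_restrict_UNIV)
  show ?thesis
  proof (rule has_integral_le[OF L R])
    fix t
    define F where "F = {e \<in> arcs G. t \<in> I e}"
    have card: "(\<Sum>e\<in>arcs G. if t \<in> I e then 1 else 0) = real (card F)"
      using fin by (simp add: F_def sum.If_cases Int_def)
    show "(if t \<in> {p a<..<p b} then real (edge_connectivity G) else 0) \<le> (\<Sum>e\<in>arcs G. if t \<in> I e then 1 else 0)"
    proof (cases "t \<in> {p a<..<p b}")
      case True
      have "\<not> Digraph_Component.connected (delete_edges G F)"
        by (rule disconnected_if_level_not_crossed[of a _ b p t])
           (use ab True in \<open>auto simp: delete_edges_def F_def I_def min_def max_def split: if_splits\<close>)
      then have "edge_connectivity G \<le> card F"
        by (intro edge_connectivity_le False) (auto simp: F_def)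
      then show ?thesis using True card by simp
    next
      case False
      then show ?thesis by (auto intro: sum_nonneg)
    qed
  qed
qed

section \<open>Eigenfunctions on the metric graph\<close>

context metric_graph
begin

text \<open>
  Grouped by vertices, the boundary terms at \<open>v\<close> share the factor \<open>g (f v)\<close>, where \<open>f v\<close> is the common
  value of \<open>u\<close> at the edge ends there, and their sum is a multiple of the Kirchhoff sum.
\<close>

lemma sum_boundary_flux_eq_0:
  assumes "natural_conditions G l u du"
  shows "(\<Sum>e\<in>arcs G. g (u e (l e)) * du e (l e) - g (u e 0) * du e 0) = 0"
proof -
  obtain f where f: "\<And>e. e \<in> arcs G \<Longrightarrow> u e 0 = f (tail G e) \<and> u e (l e) = f (head G e)"
    and kirchhoff: "\<And>v. v \<in> verts G \<Longrightarrow>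
      (\<Sum>e\<in>out_arcs G v. du e 0) + (\<Sum>e\<in>in_arcs G v. - du e (l e)) = 0"
    using assms unfolding natural_conditions_def by blast
  have "(\<Sum>e\<in>arcs G. g (u e 0) * du e 0) = (\<Sum>v\<in>verts G. \<Sum>e\<in>out_arcs G v. g (u e 0) * du e 0)"
    unfolding out_arcs_def by (rule sum.group[symmetric]) auto
  also have "\<dots> = (\<Sum>v\<in>verts G. g (f v) * (\<Sum>e\<in>out_arcs G v. du e 0))"
    by (simp add: sum_distrib_left f)
  finally have out: "(\<Sum>e\<in>arcs G. g (u e 0) * du e 0) = \<dots>" .
  have "(\<Sum>e\<in>arcs G. g (u e (l e)) * du e (l e)) = (\<Sum>v\<in>verts G. \<Sum>e\<in>in_arcs G v. g (u e (l e)) * du e (l e))"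
    unfolding in_arcs_def by (rule sum.group[symmetric]) auto
  also have "\<dots> = (\<Sum>v\<in>verts G. g (f v) * (\<Sum>e\<in>in_arcs G v. du e (l e)))"
    by (simp add: sum_distrib_left f)
  also have "\<dots> = (\<Sum>v\<in>verts G. g (f v) * (\<Sum>e\<in>out_arcs G v. du e 0))"
    using kirchhoff by (intro sum.cong) (auto simp: sum_negf)
  finally show ?thesis using out by (simp add: sum_subtractf)
qed

text \<open>
  Each increment is nonnegative, so all of them vanish and every \<open>W e\<close> is constant.  This takes the
  place of integration over the graph in the next lemmas.
\<close>

lemma derivative_eq_0_if_no_total_increment:
  assumes der: "\<And>e x. e \<in> arcs G \<Longrightarrow> x \<in> {0..l e} \<Longrightarrow>
      (W e has_real_derivative dW e x) (at x within {0..l e}) \<and> 0 \<le> dW e x"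
    and sum: "(\<Sum>e\<in>arcs G. W e (l e) - W e 0) = 0"
    and e: "e \<in> arcs G" and x: "x \<in> {0..l e}"
  shows "dW e x = 0"
proof -
  have mono: "W e y \<le> W e z" if "e \<in> arcs G" "0 \<le> y" "y \<le> z" "z \<le> l e" for e y z
  proof (rule nondecreasing_off_finite[of "{}" y z "W e"])
    have "continuous_on {0..l e} (W e)"
      using DERIV_continuous[OF conjunct1[OF der[OF \<open>e \<in> arcs G\<close>]]]
      by (simp add: continuous_on_eq_continuous_within)
    then show "continuous_on {y..z} (W e)"
      by (rule continuous_on_subset) (use that in auto)
    show "\<exists>d\<ge>0. (W e has_real_derivative d) (at w)" if w: "w \<in> {y<..<z} - {}" for w
      using der[OF \<open>e \<in> arcs G\<close>, of w] w \<open>0 \<le> y\<close> \<open>z \<le> l e\<close> by (auto simp: at_within_Icc_at)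
  qed (use that in auto)
  have "0 \<le> W e (l e) - W e 0" if "e \<in> arcs G" for e
    using mono[OF that, of 0 "l e"] length_pos[OF that] by simp
  then have "W e (l e) = W e 0"
    using sum e by (simp add: sum_nonneg_eq_0_iff)
  then have const: "W e y = W e 0" if "y \<in> {0..l e}" for y
    using mono[OF e, of 0 y] mono[OF e, of y "l e"] that by auto
  have "((\<lambda>_. W e 0) has_real_derivative dW e x) (at x within {0..l e})"
    by (rule has_field_derivative_transform_within[OF conjunct1[OF der[OF e x]] zero_less_one x]) (rule const)
  moreover have "((\<lambda>_. W e 0) has_real_derivative 0) (at x within {0..l e})" by simp
  moreover have "at x within {0..l e} \<noteq> bot"
    using x length_pos[OF e] by (simp add: trivial_limit_within islimpt_Icc)
  ultimately show ?thesis
    using has_field_derivative_unique by blast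
qed

lemma attains_max_on_graph:
  fixes w :: "'b \<Rightarrow> real \<Rightarrow> real"
  assumes "\<And>e. e \<in> arcs G \<Longrightarrow> continuous_on {0..l e} (w e)"
  obtains e0 x0 where "e0 \<in> arcs G" "x0 \<in> {0..l e0}"
    "\<And>e x. e \<in> arcs G \<Longrightarrow> x \<in> {0..l e} \<Longrightarrow> w e x \<le> w e0 x0"
proof -
  have "\<exists>x\<in>{0..l e}. \<forall>y\<in>{0..l e}. w e y \<le> w e x" if "e \<in> arcs G" for e
    using continuous_attains_sup[OF compact_Icc _ assms[OF that]] length_pos[OF that] by fastforce
  then obtain X where X: "\<And>e. e \<in> arcs G \<Longrightarrow> X e \<in> {0..l e} \<and> (\<forall>y\<in>{0..l e}. w e y \<le> w e (X e))"
    by metis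
  have "finite ((\<lambda>e. w e (X e)) ` arcs G)" "(\<lambda>e. w e (X e)) ` arcs G \<noteq> {}"
    using has_edge by auto
  from Max_in[OF this] obtain e0 where e0: "e0 \<in> arcs G" "w e0 (X e0) = Max ((\<lambda>e. w e (X e)) ` arcs G)"
    by auto
  show thesis
  proof (rule that[of e0 "X e0"])
    show "w e x \<le> w e0 (X e0)" if "e \<in> arcs G" "x \<in> {0..l e}" for e x
    proof -
      have "w e x \<le> w e (X e)" using X that by blast
      also have "\<dots> \<le> w e0 (X e0)" unfolding e0(2) using that by simp
      finally show ?thesis .
    qed
  qed (use e0 X in auto)
qed

text \<open>
  The total increment of \<open>u * u'\<close> is zero by the vertex conditions, and its derivative
  \<open>u'\<^sup>2 - lam * u\<^sup>2\<close> would be nonnegative for negative \<open>lam\<close>.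
\<close>

lemma eigenvalue_nonneg:
  assumes der: "\<And>e x. e \<in> arcs G \<Longrightarrow> x \<in> {0..l e} \<Longrightarrow>
      (u e has_real_derivative du e x) (at x within {0..l e}) \<and>
      (du e has_real_derivative - (lam * u e x)) (at x within {0..l e})"
    and nat: "natural_conditions G l u du"
    and nz: "e0 \<in> arcs G" "x0 \<in> {0..l e0}" "u e0 x0 \<noteq> 0"
  shows "0 \<le> lam"
proof (rule ccontr)
  assume "\<not> 0 \<le> lam"
  then have neg: "lam < 0" by simp
  have "(du e0 x0)\<^sup>2 - lam * (u e0 x0)\<^sup>2 = 0"
  proof (rule derivative_eq_0_if_no_total_increment[where W = "\<lambda>e x. u e x * du e x"
        and dW = "\<lambda>e x. (du e x)\<^sup>2 - lam * (u e x)\<^sup>2"])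
    show "((\<lambda>x. u e x * du e x) has_real_derivative (du e x)\<^sup>2 - lam * (u e x)\<^sup>2) (at x within {0..l e}) \<and>
        0 \<le> (du e x)\<^sup>2 - lam * (u e x)\<^sup>2" if "e \<in> arcs G" "x \<in> {0..l e}" for e x
    proof
      show "((\<lambda>x. u e x * du e x) has_real_derivative (du e x)\<^sup>2 - lam * (u e x)\<^sup>2) (at x within {0..l e})"
        using der[OF that] by (auto intro!: derivative_eq_intros simp: power2_eq_square algebra_simps)
      have "lam * (u e x)\<^sup>2 \<le> 0" using neg by (simp add: mult_le_0_iff)
      then show "0 \<le> (du e x)\<^sup>2 - lam * (u e x)\<^sup>2" using zero_le_power2[of "du e x"] by linarith
    qed
    show "(\<Sum>e\<in>arcs G. u e (l e) * du e (l e) - u e 0 * du e 0) = 0"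
      by (rule sum_boundary_flux_eq_0[OF nat, of "\<lambda>t. t"])
  qed (fact nz)+
  moreover have "lam * (u e0 x0)\<^sup>2 < 0" using neg nz by (simp add: mult_neg_pos)
  ultimately show False by (smt (verit) zero_le_power2)
qed

text \<open>
  Eigenfunctions of nonzero eigenvalues have mean zero: \<open>k\<^sup>2 * u\<close> is the derivative of \<open>- u'\<close>, whose
  total increment vanishes.  The factor \<open>\<sigma>\<close> allows for either sign.
\<close>

lemma one_signed_eigenfunction_eq_0:
  assumes h: "\<And>e. e \<in> arcs G \<Longrightarrow> helmholtz_on k (l e) (u e) (du e)"
    and nat: "natural_conditions G l u du" and k: "0 < k"
    and sign: "\<And>e x. e \<in> arcs G \<Longrightarrow> x \<in> {0..l e} \<Longrightarrow> 0 \<le> \<sigma> * u e x"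
    and e: "e \<in> arcs G" and x: "x \<in> {0..l e}"
  shows "\<sigma> * u e x = 0"
proof -
  have "k\<^sup>2 * (\<sigma> * u e x) = 0"
  proof (rule derivative_eq_0_if_no_total_increment[where W = "\<lambda>e x. - \<sigma> * du e x"
        and dW = "\<lambda>e x. k\<^sup>2 * (\<sigma> * u e x)"])
    show "((\<lambda>x. - \<sigma> * du e x) has_real_derivative k\<^sup>2 * (\<sigma> * u e x)) (at x within {0..l e}) \<and>
        0 \<le> k\<^sup>2 * (\<sigma> * u e x)" if "e \<in> arcs G" "x \<in> {0..l e}" for e x
    proof
      have "(du e has_real_derivative - (k\<^sup>2 * u e x)) (at x within {0..l e})"
        using h[OF that(1)] that(2) unfolding helmholtz_on_def by blast
      from DERIV_cmult[OF this, of "- \<sigma>"]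
      show "((\<lambda>x. - \<sigma> * du e x) has_real_derivative k\<^sup>2 * (\<sigma> * u e x)) (at x within {0..l e})"
        by (simp add: mult.left_commute)
    qed (use sign[OF that] in simp)
    show "(\<Sum>e\<in>arcs G. - \<sigma> * du e (l e) - - \<sigma> * du e 0) = 0"
      by (rule sum_boundary_flux_eq_0[OF nat, of "\<lambda>_. - \<sigma>"])
  qed (fact e x)+
  then show ?thesis using k by simp
qed

text \<open>
  Here the three estimates meet: the calibration bounds the total variation of the profile from above,
  cuts and the two extremal edges bound it from below, and the caps on these two edges account for the
  levels outside the range of the vertex values.
\<close>

lemma wave_number_bound:
  assumes h: "\<And>e. e \<in> arcs G \<Longrightarrow> helmholtz_on k (l e) (u e) (du e)"
    and nat: "natural_conditions G l u du" and k: "0 < k"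
    and nz: "e' \<in> arcs G" "x' \<in> {0..l e'}" "u e' x' \<noteq> 0"
  shows "real (edge_connectivity G) * pi
    \<le> k * (total_length G l + max_edge_length G l * max (real (edge_connectivity G) - 2) 0)"
proof -
  define \<eta> where "\<eta> = real (edge_connectivity G)"
  define L where "L = total_length G l"
  define l\<^sub>m where "l\<^sub>m = max_edge_length G l"
  have cont: "continuous_on {0..l e} (u e)" if "e \<in> arcs G" for e
    using helmholtz_on_continuous(1)[OF h[OF that]] .
  obtain e0 x0 where e0: "e0 \<in> arcs G" "x0 \<in> {0..l e0}"
    and max: "\<And>e x. e \<in> arcs G \<Longrightarrow> x \<in> {0..l e} \<Longrightarrow> u e x \<le> u e0 x0"
    using attains_max_on_graph[of u, OF cont] by blast
  obtain e1 x1 where e1: "e1 \<in> arcs G" "x1 \<in> {0..l e1}"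
    and min: "\<And>e x. e \<in> arcs G \<Longrightarrow> x \<in> {0..l e} \<Longrightarrow> - u e x \<le> - u e1 x1"
    using attains_max_on_graph[of "\<lambda>e x. - u e x", OF continuous_on_minus[OF cont]] by blast
  define M where "M = u e0 x0"
  define m where "m = - u e1 x1"
  have M: "0 < M"
  proof (rule ccontr)
    assume "\<not> 0 < M"
    then have "0 \<le> -1 * u e x" if "e \<in> arcs G" "x \<in> {0..l e}" for e x
      using max[OF that] by (simp add: M_def)
    from one_signed_eigenfunction_eq_0[OF h nat k this nz(1,2)] nz(3) show False by simp
  qed
  have m: "0 < m"
  proof (rule ccontr)
    assume "\<not> 0 < m"
    then have "0 \<le> 1 * u e x" if "e \<in> arcs G" "x \<in> {0..l e}" for e x
      using min[OF that] by (simp add: m_def)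
    from one_signed_eigenfunction_eq_0[OF h nat k this nz(1,2)] nz(3) show False by simp
  qed
  have bound: "- m \<le> u e x \<and> u e x \<le> M" if "e \<in> arcs G" "x \<in> {0..l e}" for e x
    using max[OF that] min[OF that] by (simp add: M_def m_def)
  obtain f where f: "\<And>e. e \<in> arcs G \<Longrightarrow> u e 0 = f (tail G e) \<and> u e (l e) = f (head G e)"
    using nat unfolding natural_conditions_def by blast
  \<comment> \<open>The extreme vertex values are taken over the ends of edges, where \<open>f\<close> is a value of \<open>u\<close>.\<close>
  define V where "V = tail G ` arcs G \<union> head G ` arcs G"
  have V: "finite (f ` V)" "f ` V \<noteq> {}" "V \<subseteq> verts G"
    using has_edge by (auto simp: V_def)
  have "Min (f ` V) \<in> f ` V" using V by (intro Min_in)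
  then obtain a where a: "a \<in> V" "f a = Min (f ` V)" by auto
  have a_ext: "f a \<le> f v" if "v \<in> V" for v
    using Min_le[OF V(1), of "f v"] that a(2) by simp
  have "Max (f ` V) \<in> f ` V" using V by (intro Max_in)
  then obtain b where b: "b \<in> V" "f b = Max (f ` V)" by auto
  have b_ext: "f v \<le> f b" if "v \<in> V" for v
    using Max_ge[OF V(1), of "f v"] that b(2) by simp
  have fb: "- m \<le> f v \<and> f v \<le> M" if v: "v \<in> V" for v
  proof -
    obtain e where e: "e \<in> arcs G" "v = tail G e \<or> v = head G e" using v unfolding V_def by blast
    then show ?thesis using bound[OF e(1), of 0] bound[OF e(1), of "l e"] f[OF e(1)] length_pos[OF e(1)] by auto
  qed
  define p where "p v = profile M m (f v)" for v
  have p: "p a \<le> p v" "p v \<le> p b" if "v \<in> V" for v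
    unfolding p_def using profile_mono[OF M m] a(1) b(1) a_ext b_ext fb that by auto
  define D where "D = p b - p a"
  have "0 \<le> D" using p a(1) by (simp add: D_def)
  have range: "- (pi / 4) \<le> p v" "p v \<le> pi / 4" if "v \<in> V" for v
    unfolding p_def
    using profile_mono[OF M m, of "- m" "f v"] profile_mono[OF M m, of "f v" M]
      profile_extreme[OF M m] fb[OF that] M m by auto
  have "D \<le> pi / 2" using range[OF a(1)] range[OF b(1)] by (simp add: D_def)

  have "\<forall>e\<in>arcs G. \<exists>lo hi. (\<forall>x\<in>{0..l e}. lo \<le> profile M m (u e x) \<and> profile M m (u e x) \<le> hi) \<and>
    2 * k * (2 * (hi - lo) - \<bar>p (head G e) - p (tail G e)\<bar>)
      \<le> k\<^sup>2 * l e + (weight M m (u e (l e)) * du e (l e) - weight M m (u e 0) * du e 0)"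
    using profile_variation_on_edge[OF h k length_pos M m bound] f unfolding p_def by simp
  then obtain lo hi where
    lohi: "\<And>e x. e \<in> arcs G \<Longrightarrow> x \<in> {0..l e} \<Longrightarrow> lo e \<le> profile M m (u e x) \<and> profile M m (u e x) \<le> hi e"
    and var: "\<And>e. e \<in> arcs G \<Longrightarrow> 2 * k * (2 * (hi e - lo e) - \<bar>p (head G e) - p (tail G e)\<bar>)
      \<le> k\<^sup>2 * l e + (weight M m (u e (l e)) * du e (l e) - weight M m (u e 0) * du e 0)"
    by metis
  have ends: "lo e \<le> min (p (head G e)) (p (tail G e))" "max (p (head G e)) (p (tail G e)) \<le> hi e"
    if "e \<in> arcs G" for e
    using lohi[OF that, of 0] lohi[OF that, of "l e"] f[OF that] length_pos[OF that]
    by (auto simp: p_def)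
  have "(\<Sum>e\<in>arcs G. 2 * k * (2 * (hi e - lo e) - \<bar>p (head G e) - p (tail G e)\<bar>))
      \<le> (\<Sum>e\<in>arcs G. k\<^sup>2 * l e + (weight M m (u e (l e)) * du e (l e) - weight M m (u e 0) * du e 0))"
    by (rule sum_mono) (rule var)
  also have "\<dots> = k\<^sup>2 * L"
    using sum_boundary_flux_eq_0[OF nat, of "weight M m"]
    by (simp add: sum.distrib L_def total_length_def sum_distrib_left)
  finally have total: "2 * k * (\<Sum>e\<in>arcs G. 2 * (hi e - lo e) - \<bar>p (head G e) - p (tail G e)\<bar>) \<le> k\<^sup>2 * L"
    by (simp add: sum_distrib_left)
  \<comment> \<open>The edge carrying the maximum of \<open>u\<close> has to climb from its end values, at most \<open>p b\<close>, to \<open>pi / 4\<close>.\<close>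
  have top: "pi / 4 - p b \<le> (\<Sum>e\<in>arcs G. hi e - max (p (head G e)) (p (tail G e)))"
  proof -
    have "pi / 4 \<le> hi e0"
      using lohi[OF e0] profile_extreme(1)[OF M m] by (simp add: M_def)
    moreover have "max (p (head G e0)) (p (tail G e0)) \<le> p b"
      using p e0 by (simp add: V_def)
    moreover have "hi e0 - max (p (head G e0)) (p (tail G e0)) \<le> (\<Sum>e\<in>arcs G. hi e - max (p (head G e)) (p (tail G e)))"
      by (rule member_le_sum) (use e0 ends in auto)
    ultimately show ?thesis by linarith
  qed
  have bottom: "p a + pi / 4 \<le> (\<Sum>e\<in>arcs G. min (p (head G e)) (p (tail G e)) - lo e)"
  proof -
    have "lo e1 \<le> - pi / 4"
      using lohi[OF e1] profile_extreme(2)[OF M m] by (simp add: m_def)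
    moreover have "p a \<le> min (p (head G e1)) (p (tail G e1))"
      using p e1 by (simp add: V_def)
    moreover have "min (p (head G e1)) (p (tail G e1)) - lo e1 \<le> (\<Sum>e\<in>arcs G. min (p (head G e)) (p (tail G e)) - lo e)"
      by (rule member_le_sum) (use e1 ends in auto)
    ultimately show ?thesis by linarith
  qed
  have cut: "\<eta> * D \<le> (\<Sum>e\<in>arcs G. \<bar>p (head G e) - p (tail G e)\<bar>)"
    unfolding \<eta>_def D_def using a b V p
    by (intro edge_connectivity_times_oscillation_le) auto
  have split: "(\<Sum>e\<in>arcs G. 2 * (hi e - lo e) - \<bar>p (head G e) - p (tail G e)\<bar>)
      = (\<Sum>e\<in>arcs G. \<bar>p (head G e) - p (tail G e)\<bar>)
        + 2 * (\<Sum>e\<in>arcs G. hi e - max (p (head G e)) (p (tail G e)))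
        + 2 * (\<Sum>e\<in>arcs G. min (p (head G e)) (p (tail G e)) - lo e)"
    unfolding sum_distrib_left sum.distrib[symmetric] by (rule sum.cong) (auto simp: max_def min_def)
  have "\<eta> * D + 2 * (pi / 4 - p b) + 2 * (p a + pi / 4)
      \<le> (\<Sum>e\<in>arcs G. 2 * (hi e - lo e) - \<bar>p (head G e) - p (tail G e)\<bar>)"
    unfolding split by (intro add_mono mult_left_mono cut top bottom) simp_all
  moreover have "\<eta> * D + 2 * (pi / 4 - p b) + 2 * (p a + pi / 4) = pi + (\<eta> - 2) * D"
    by (simp add: D_def algebra_simps)
  ultimately have "2 * k * (pi + (\<eta> - 2) * D) \<le> 2 * k * (\<Sum>e\<in>arcs G. 2 * (hi e - lo e) - \<bar>p (head G e) - p (tail G e)\<bar>)"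
    using k by (intro mult_left_mono) simp_all
  from order_trans[OF this total] have "k * (2 * (pi + (\<eta> - 2) * D)) \<le> k * (k * L)"
    by (simp only: power2_eq_square mult_ac)
  then have main: "2 * (pi + (\<eta> - 2) * D) \<le> k * L" using k by simp

  have le_l\<^sub>m: "l e \<le> l\<^sub>m" if "e \<in> arcs G" for e
    unfolding l\<^sub>m_def max_edge_length_def using that by simp
  \<comment> \<open>The edge carrying the maximum contains the whole cap above any height that no vertex exceeds.\<close>
  have cap_top: "2 * (\<theta> / k) \<le> l\<^sub>m" if "0 \<le> \<theta>" "\<theta> \<le> pi" "f b \<le> M * cos \<theta>" for \<theta>
  proof -
    have "tail G e0 \<in> V" "head G e0 \<in> V" using e0 by (auto simp: V_def)
    then have "u e0 0 \<le> M * cos \<theta>" "u e0 (l e0) \<le> M * cos \<theta>"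
      using f[OF e0(1)] b_ext that(3) by (auto intro: order_trans)
    then have "2 * (\<theta> / k) \<le> l e0"
      using that k M bound[OF e0(1)] e0
      by (intro edge_length_ge_cap[OF h[OF e0(1)] k length_pos[OF e0(1)] e0(2) M_def[symmetric]]) auto
    then show ?thesis using le_l\<^sub>m[OF e0(1)] by simp
  qed
  have cap_bottom: "2 * (\<theta> / k) \<le> l\<^sub>m" if "0 \<le> \<theta>" "\<theta> \<le> pi" "- f a \<le> m * cos \<theta>" for \<theta>
  proof -
    have "tail G e1 \<in> V" "head G e1 \<in> V" using e1 by (auto simp: V_def)
    then have "- u e1 0 \<le> m * cos \<theta>" "- u e1 (l e1) \<le> m * cos \<theta>"
      using f[OF e1(1)] a_ext[of "tail G e1"] a_ext[of "head G e1"] that(3) by auto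
    moreover have "- u e1 x \<le> m" if "x \<in> {0..l e1}" for x
      using bound[OF e1(1) that] by simp
    ultimately have "2 * (\<theta> / k) \<le> l e1"
      using that k m e1
      by (intro edge_length_ge_cap[OF helmholtz_on_uminus[OF h[OF e1(1)]] k length_pos[OF e1(1)] e1(2) m_def[symmetric]]) auto
    then show ?thesis using le_l\<^sub>m[OF e1(1)] by simp
  qed
  \<comment> \<open>If \<open>0\<close> lies between the extreme vertex values, the two caps have half-angle at most \<open>pi / 2\<close> and each
    pays for its own part of the deficit, the lengths of both being bounded by the longest edge.
    Otherwise all vertex values lie strictly on one side of zero, and the half wave on the
    opposite side, of length \<open>pi / k\<close>, fits into one edge and pays for the whole deficit.\<close>
  have deficit: "pi / 2 - D \<le> k * l\<^sub>m / 2"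
  proof (cases "f a \<le> 0 \<and> 0 \<le> f b")
    case True
    have hb: "0 \<le> f b / M" "f b / M \<le> 1" using True M fb[OF b(1)] by auto
    have "2 * (arccos (f b / M) / k) \<le> l\<^sub>m"
      using hb M by (intro cap_top) (auto simp: arccos_lbound arccos_ubound)
    then have "arccos (f b / M) \<le> k * l\<^sub>m / 2" using k by (simp add: field_simps)
    moreover have "p b = half_disc (f b / M)" using True by (simp add: p_def profile_def)
    ultimately have top': "pi / 4 - p b \<le> k * l\<^sub>m / 4"
      using half_disc_cap[OF hb] by linarith
    define c where "c = - f a / m"
    have c: "0 \<le> c" "c \<le> 1" using True m fb[OF a(1)] by (auto simp: c_def field_simps)
    have "2 * (arccos c / k) \<le> l\<^sub>m"
    proof (rule cap_bottom)
      show "- f a \<le> m * cos (arccos c)" using cos_arccos[of c] c m by (simp only: c_def) simp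
    qed (use c in \<open>auto intro: arccos_lbound arccos_ubound\<close>)
    then have "arccos c \<le> k * l\<^sub>m / 2" using k by (simp add: field_simps)
    moreover have "p a = - half_disc c"
      using True half_disc_minus[of c] c by (simp add: p_def profile_def c_def)
    ultimately have "pi / 4 + p a \<le> k * l\<^sub>m / 4"
      using half_disc_cap[OF c] by linarith
    with top' show ?thesis by (simp add: D_def)
  next
    case False
    then have "2 * ((pi / 2) / k) \<le> l\<^sub>m"
      using cap_top[of "pi / 2"] cap_bottom[of "pi / 2"] by fastforce
    then have "pi \<le> k * l\<^sub>m" using k by (simp add: field_simps)
    then show ?thesis using \<open>0 \<le> D\<close> by linarith
  qed
  have "\<eta> * pi \<le> k * (L + l\<^sub>m * max (\<eta> - 2) 0)"
  proof (cases "\<eta> \<le> 2")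
    case True
    then have "(2 - \<eta>) * D \<le> (2 - \<eta>) * (pi / 2)"
      using \<open>D \<le> pi / 2\<close> by (intro mult_left_mono) auto
    then show ?thesis using main True by (simp add: max_def algebra_simps)
  next
    case False
    then have "(\<eta> - 2) * (pi - k * l\<^sub>m) \<le> (\<eta> - 2) * (2 * D)"
      using deficit by (intro mult_left_mono) auto
    then show ?thesis using main False by (simp add: max_def algebra_simps)
  qed
  then show ?thesis by (simp add: \<eta>_def L_def l\<^sub>m_def)
qed

end

theorem corollary3p5:
  fixes G :: "('a, 'b) pre_digraph" and l :: "'b \<Rightarrow> real" and L l_max \<mu>\<^sub>1 :: real and \<eta> :: nat
  assumes "metric_graph G l"
    and "degree_two_suppressed G"
    and "L = total_length G l"
    and "l_max = max_edge_length G l"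
    and "\<eta> = edge_connectivity G"
    and "smallest_nonzero_eigenvalue G l \<mu>\<^sub>1"
  shows "\<mu>\<^sub>1 \<ge> (real \<eta>)\<^sup>2 * pi\<^sup>2 / (L + l_max * max (real \<eta> - 2) 0)\<^sup>2"
proof -
  interpret metric_graph G l by fact
  obtain u du ddu e0 x0 where nz: "e0 \<in> arcs G" "x0 \<in> {0..l e0}" "u e0 x0 \<noteq> 0"
    and ode: "\<And>e x. e \<in> arcs G \<Longrightarrow> x \<in> {0..l e} \<Longrightarrow>
      (u e has_real_derivative du e x) (at x within {0..l e}) \<and>
      (du e has_real_derivative ddu e x) (at x within {0..l e}) \<and> - ddu e x = \<mu>\<^sub>1 * u e x"
    and nat: "natural_conditions G l u du" and "\<mu>\<^sub>1 \<noteq> 0"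
    using assms(6) unfolding smallest_nonzero_eigenvalue_def laplacian_eigenvalue_def
      laplacian_eigenfunction_def by blast
  have der: "(u e has_real_derivative du e x) (at x within {0..l e}) \<and>
      (du e has_real_derivative - (\<mu>\<^sub>1 * u e x)) (at x within {0..l e})"
    if "e \<in> arcs G" "x \<in> {0..l e}" for e x
  proof -
    have "ddu e x = - (\<mu>\<^sub>1 * u e x)" using ode[OF that] by linarith
    then show ?thesis using ode[OF that] by metis
  qed
  have "0 < \<mu>\<^sub>1"
    using eigenvalue_nonneg[OF der nat nz] \<open>\<mu>\<^sub>1 \<noteq> 0\<close> by simp
  define k where "k = sqrt \<mu>\<^sub>1"
  have k: "0 < k" "k\<^sup>2 = \<mu>\<^sub>1" using \<open>0 < \<mu>\<^sub>1\<close> by (simp_all add: k_def)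
  define N where "N = L + l_max * max (real \<eta> - 2) 0"
  have "helmholtz_on k (l e) (u e) (du e)" if "e \<in> arcs G" for e
    using der[OF that] unfolding helmholtz_on_def k(2) by blast
  from wave_number_bound[OF this nat k(1) nz]
  have bound: "real \<eta> * pi \<le> k * N" by (simp add: assms(3-5) N_def)
  have "0 < L"
    unfolding assms(3) total_length_def using has_edge length_pos by (intro sum_pos) auto
  moreover have "0 < l_max"
    unfolding assms(4) max_edge_length_def using has_edge length_pos by (simp add: Max_gr_iff) blast
  ultimately have "0 < N" by (simp add: N_def add_pos_nonneg)
  have "(real \<eta> * pi)\<^sup>2 \<le> (k * N)\<^sup>2"
    using bound by (intro power_mono) auto
  then have "(real \<eta>)\<^sup>2 * pi\<^sup>2 / N\<^sup>2 \<le> k\<^sup>2"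
    using \<open>0 < N\<close> by (simp add: power_mult_distrib field_simps)
  then show ?thesis by (simp add: k(2) N_def)
qed

end
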